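(* For every integer $n\geq 1$ let \[ Q_{n}(x_1,\ldots,x_{n}) \coloneqq \prod_{i=1}^{n}\prod_{j=i}^{n} \left( 1-\prod_{k=i}^j x_k \right) \] and $M_n\coloneqq \max_{(x_1,\ldots,x_n)\in [-1,1]^n} Q_n(x_1,\ldots,x_n)$. For every integer $n\geq 2$ let \[ P_n\coloneqq \sup \prod_{1\leq i<j\leq n}\left( 1 -\frac{y_i}{y_j}\right), \] where the supremum is taken over all $n$-tuples $(y_1,\ldots,y_n)$ of nonzero real numbers satisfying $|y_1|<|y_2|<\cdots<|y_n|$. Then $M_n = 2^{\lfloor (n+1)/2\rfloor}$ for every $n\geq 1$, and $P_n = M_{n-1} = 2^{\lfloor n/2\rfloor}$ for every $n\geq 2$.
   Context: $\lfloor t\rfloor$ denotes the integer part of the real number $t$. *)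

theory Defs
  imports Complex_Main "HOL-Library.FuncSet"
begin

text \<open>An \<open>n\<close>-tuple \<open>(x\<^sub>1, \<dots>, x\<^sub>n)\<close> of reals is an extensional function on the index set \<open>{1..n}\<close>.\<close>

definition Q_prod :: "nat \<Rightarrow> (nat \<Rightarrow> real) \<Rightarrow> real" where
  "Q_prod n x = (\<Prod>i\<in>{1..n}. \<Prod>j\<in>{i..n}. 1 - (\<Prod>k\<in>{i..j}. x k))"

definition cube :: "nat \<Rightarrow> (nat \<Rightarrow> real) set" where
  "cube n = {1..n} \<rightarrow>\<^sub>E {-1..1}"

definition M_max :: "nat \<Rightarrow> real" where
  "M_max n = (GREATEST m. m \<in> Q_prod n ` cube n)"

definition ratio_prod :: "nat \<Rightarrow> (nat \<Rightarrow> real) \<Rightarrow> real" where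
  "ratio_prod n y = (\<Prod>i\<in>{1..n}. \<Prod>j\<in>{i<..n}. 1 - y i / y j)"

definition abs_increasing :: "nat \<Rightarrow> (nat \<Rightarrow> real) set" where
  "abs_increasing n =
    {y \<in> {1..n} \<rightarrow>\<^sub>E (UNIV - {0}). strict_mono_on {1..n} (\<lambda>i. \<bar>y i\<bar>)}"

definition P_sup :: "nat \<Rightarrow> real" where
  "P_sup n = Sup (ratio_prod n ` abs_increasing n)"

end

theory Submission
  imports Defs
begin

text \<open>
  Write \<open>c\<^sub>i\<^sub>j\<close> for the absolute value of the product of \<open>x\<^sub>k\<close> over \<open>i \<le> k < j\<close> and
  \<open>e\<^sub>i e\<^sub>j\<close> for its sign. Every factor is at most \<open>(1 + c\<^sub>i\<^sub>j)\<close> to the power \<open>- e\<^sub>i e\<^sub>j\<close>,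
  with equality for sign \<open>-1\<close>, and in the other case because \<open>(1 - c)(1 + c) \<le> 1\<close>.
  The upper bound thus amounts to a lower bound for the quadratic form of the kernel
  \<open>f\<^sub>i\<^sub>j = ln (1 + c\<^sub>i\<^sub>j)\<close> on the \<open>m = n + 1\<close> signs \<open>e\<^sub>i\<close>. Since \<open>ln (1 + exp (-u))\<close> is convex and
  decreasing, the kernel is (as in Polya's criterion) a nonnegative combination of indicators
  of intervals: \<open>f\<^sub>i\<^sub>j\<close> is the sum of weights \<open>w\<^sub>p\<^sub>q \<ge> 0\<close> over the \<open>[p, q]\<close> that contain \<open>i\<close> and \<open>j\<close>.
  Hence the form is the sum of \<open>w\<^sub>p\<^sub>q\<close> times the square of the sum of the signs over \<open>[p, q]\<close>.
  Such a square has the parity of \<open>q - p + 1\<close>, so it is at least the alternating sum of ones over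
  \<open>[p, q]\<close>; therefore the form is at least the alternating sum of the diagonal
  entries \<open>ln 2\<close>, which is \<open>(m mod 2) ln 2\<close>.

  The bound is attained at \<open>(-1, 0, -1, 0, \<dots>)\<close>, and \<open>x\<^sub>k = y\<^sub>k / y\<^sub>k\<^sub>+\<^sub>1\<close> identifies the supremum
  with that of \<open>Q\<close> over the points with \<open>0 < \<bar>x\<^sub>k\<bar> < 1\<close>, which approach this maximizer.
\<close>

section \<open>Parity of sums of odd integers over an interval\<close>

lemma sum_alternating_le_1: "(\<Sum>i\<in>{p..q}. (-1) ^ Suc i) \<le> (1::int)"
proof -
  have *: "(\<Sum>i\<in>{p..<p+n}. (-1) ^ Suc i) = (if odd n then (-1) ^ Suc p else (0::int))" for n
    by (induction n) (auto simp: power_add)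
  show ?thesis
  proof (cases "p \<le> q")
    case True
    then have "{p..q} = {p..<p + (Suc q - p)}" by auto
    then show ?thesis
      by (simp only: *) (auto simp: minus_one_power_iff)
  qed simp
qed

lemma even_sum_odd_iff:
  fixes e :: "'a \<Rightarrow> int"
  assumes "finite A" "\<And>i. i \<in> A \<Longrightarrow> odd (e i)"
  shows "even (sum e A) \<longleftrightarrow> even (card A)"
  using assms by (induction A rule: finite_induct) auto

lemma sum_alternating_le_square:
  fixes e :: "nat \<Rightarrow> int"
  assumes "\<And>i. odd (e i)"
  shows "(\<Sum>i\<in>{p..q}. (-1) ^ Suc i) \<le> (\<Sum>i\<in>{p..q}. e i)\<^sup>2"
proof (cases "(\<Sum>i\<in>{p..q}. (-1) ^ Suc i) = (1::int)")
  case True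
  \<comment> \<open>Both sums have only odd terms, so each has the parity of
    \<open>card {p..q}\<close>. Hence \<open>sum e {p..q}\<close> is odd and cannot vanish.\<close>
  then have "odd (\<Sum>i\<in>{p..q}. (-1::int) ^ Suc i)" by simp
  then have "odd (card {p..q})"
    using even_sum_odd_iff[of "{p..q}" "\<lambda>i. (-1) ^ Suc i"] by simp
  then have "odd (sum e {p..q})"
    using even_sum_odd_iff[of "{p..q}" e] assms by simp
  then have "sum e {p..q} \<noteq> 0" by auto
  then have "(sum e {p..q})\<^sup>2 > 0" by simp
  then show ?thesis using True by linarith
next
  case False
  then have "(\<Sum>i\<in>{p..q}. (-1) ^ Suc i) \<le> (0::int)"
    using sum_alternating_le_1[of p q] by linarith
  then show ?thesis by (meson order_trans zero_le_power2)
qed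

section \<open>Decomposition of a kernel into intervals and its quadratic form\<close>

lemma sum_second_difference:
  fixes f :: "nat \<Rightarrow> nat \<Rightarrow> real"
  assumes "i \<in> {1..m}" "j \<in> {1..m}"
    and "\<And>k. k \<le> Suc m \<Longrightarrow> k > 0 \<Longrightarrow> f 0 k = 0"
    and "\<And>k. k \<le> m \<Longrightarrow> f k (Suc m) = 0"
  shows "(\<Sum>p\<in>{1..i}. \<Sum>q\<in>{j..m}.
            f p q - f (p - 1) q - f p (Suc q) + f (p - 1) (Suc q)) = f i j"
proof -
  \<comment> \<open>The inner sum telescopes up to column \<open>Suc m\<close>, the outer one down
    to row \<open>0\<close>; \<open>f\<close> vanishes on both borders, so only \<open>f i j\<close>
    survives.\<close>
  have "(\<Sum>q\<in>{j..m}. f p q - f (p - 1) q - f p (Suc q) + f (p - 1) (Suc q))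
      = f p j - f (p - 1) j" if "p \<in> {1..i}" for p
  proof -
    have "(\<Sum>q\<in>{j..m}. f p q - f (p - 1) q - f p (Suc q) + f (p - 1) (Suc q))
        = - (\<Sum>q\<in>{j..m}. (f p (Suc q) - f (p - 1) (Suc q)) - (f p q - f (p - 1) q))"
      unfolding sum_negf[symmetric] by (intro sum.cong) auto
    also have "\<dots> = - ((f p (Suc m) - f (p - 1) (Suc m)) - (f p j - f (p - 1) j))"
      using assms(2) by (subst sum_Suc_diff) auto
    finally show ?thesis using assms that by auto
  qed
  then have "(\<Sum>p\<in>{1..i}. \<Sum>q\<in>{j..m}.
            f p q - f (p - 1) q - f p (Suc q) + f (p - 1) (Suc q))
      = (\<Sum>p\<in>{Suc 0..i}. f p j - f (p - 1) j)"
    by simp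
  also have "\<dots> = f i j - f 0 j"
    by (rule sum_telescope'') simp
  finally show ?thesis using assms by auto
qed

text \<open>Each off-diagonal pair occurs twice. Writing its larger index as \<open>Suc j\<close>
  matches the index pairs of the factors in \<open>Q_prod\<close>.\<close>

lemma sum_symmetric_square:
  fixes g :: "nat \<Rightarrow> nat \<Rightarrow> real"
  shows "(\<Sum>i\<in>{1..Suc n}. \<Sum>j\<in>{1..Suc n}. g (min i j) (max i j))
       = (\<Sum>i\<in>{1..Suc n}. g i i) + 2 * (\<Sum>i\<in>{1..n}. \<Sum>j\<in>{i..n}. g i (Suc j))"
proof (induction n)
  case (Suc n)
  let ?N = "Suc (Suc n)"
  have "(\<Sum>i\<in>{1..?N}. \<Sum>j\<in>{1..?N}. g (min i j) (max i j))
      = (\<Sum>i\<in>{1..Suc n}. \<Sum>j\<in>{1..Suc n}. g (min i j) (max i j))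
        + 2 * (\<Sum>i\<in>{1..Suc n}. g i ?N) + g ?N ?N"
    by (simp add: sum.distrib min_def max_def)
  moreover have "(\<Sum>i\<in>{1..Suc n}. \<Sum>j\<in>{i..Suc n}. g i (Suc j))
      = (\<Sum>i\<in>{1..n}. \<Sum>j\<in>{i..n}. g i (Suc j)) + (\<Sum>i\<in>{1..Suc n}. g i ?N)"
    by (simp add: sum.distrib)
  ultimately show ?case using Suc.IH by simp
qed simp

text \<open>An interval contains both \<open>i\<close> and \<open>j\<close> iff it contains their
  minimum and maximum. The fixed ranges on the right allow the sums to be exchanged.\<close>

lemma sum_indicator_intervals:
  fixes w :: "nat \<Rightarrow> nat \<Rightarrow> real"
  assumes "i \<in> {1..m}" "j \<in> {1..m}"
  shows "(\<Sum>p\<in>{1..min i j}. \<Sum>q\<in>{max i j..m}. w p q)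
       = (\<Sum>p\<in>{1..m}. \<Sum>q\<in>{1..m}. if i \<in> {p..q} \<and> j \<in> {p..q} then w p q else 0)"
proof -
  have "(\<Sum>p\<in>{1..m}. \<Sum>q\<in>{1..m}. if i \<in> {p..q} \<and> j \<in> {p..q} then w p q else 0)
      = (\<Sum>p\<in>{1..m}. if p \<le> min i j then (\<Sum>q\<in>{1..m}. if max i j \<le> q then w p q else 0) else 0)"
  proof (rule sum.cong[OF refl])
    fix p
    show "(\<Sum>q\<in>{1..m}. if i \<in> {p..q} \<and> j \<in> {p..q} then w p q else 0)
        = (if p \<le> min i j then (\<Sum>q\<in>{1..m}. if max i j \<le> q then w p q else 0) else 0)"
      by (cases "p \<le> min i j") (auto intro!: sum.cong)
  qed
  also have "\<dots> = (\<Sum>p\<in>{1..m} \<inter> {p. p \<le> min i j}. \<Sum>q\<in>{1..m} \<inter> {q. max i j \<le> q}. w p q)"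
    by (simp only: sum.inter_restrict finite_atLeastAtMost mem_Collect_eq)
  also have "{1..m} \<inter> {p. p \<le> min i j} = {1..min i j}" using assms by auto
  also have "{1..m} \<inter> {q. max i j \<le> q} = {max i j..m}" using assms by auto
  finally show ?thesis by simp
qed

lemma interval_kernel_lower_bound:
  fixes f :: "nat \<Rightarrow> nat \<Rightarrow> real" and e :: "nat \<Rightarrow> int"
  assumes "\<And>k. k \<le> Suc m \<Longrightarrow> k > 0 \<Longrightarrow> f 0 k = 0"
    and "\<And>k. k \<le> m \<Longrightarrow> f k (Suc m) = 0"
    and nonneg: "\<And>p q. 1 \<le> p \<Longrightarrow> p \<le> q \<Longrightarrow> q \<le> m \<Longrightarrow>
      f p q - f (p - 1) q - f p (Suc q) + f (p - 1) (Suc q) \<ge> 0"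
    and odd: "\<And>i. odd (e i)"
  shows "(\<Sum>i\<in>{1..m}. (-1) ^ Suc i * f i i)
       \<le> (\<Sum>i\<in>{1..m}. \<Sum>j\<in>{1..m}. e i * e j * f (min i j) (max i j))"
proof -
  define w where "w p q = f p q - f (p - 1) q - f p (Suc q) + f (p - 1) (Suc q)" for p q
  let ?I = "{1..m}"
  have f: "f (min i j) (max i j)
      = (\<Sum>p\<in>?I. \<Sum>q\<in>?I. if i \<in> {p..q} \<and> j \<in> {p..q} then w p q else 0)"
    if "i \<in> ?I" "j \<in> ?I" for i j
  proof -
    have "f (min i j) (max i j) = (\<Sum>p\<in>{1..min i j}. \<Sum>q\<in>{max i j..m}. w p q)"
      unfolding w_def using assms that by (intro sum_second_difference[symmetric]) auto
    then show ?thesis using sum_indicator_intervals[OF that] by simp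
  qed
  have swap: "(\<Sum>i\<in>?I. \<Sum>p\<in>?I. \<Sum>q\<in>?I. h i p q) = (\<Sum>p\<in>?I. \<Sum>q\<in>?I. \<Sum>i\<in>?I. h i p q)"
    for h :: "nat \<Rightarrow> nat \<Rightarrow> nat \<Rightarrow> real"
    by (subst sum.swap, rule sum.cong, simp, subst sum.swap, simp)
  have restrict: "(\<Sum>i\<in>?I. if i \<in> {p..q} then h i else 0) = (\<Sum>i\<in>{p..q}. h i)"
    if "p \<in> ?I" "q \<in> ?I" for p q and h :: "nat \<Rightarrow> real"
  proof -
    have "{p..q} = ?I \<inter> {p..q}" using that by auto
    then show ?thesis by (metis sum.inter_restrict finite_atLeastAtMost)
  qed
  have "(\<Sum>i\<in>?I. (-1) ^ Suc i * f i i)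
      = (\<Sum>i\<in>?I. \<Sum>p\<in>?I. \<Sum>q\<in>?I. (if i \<in> {p..q} then (-1) ^ Suc i * w p q else 0))"
  proof (rule sum.cong)
    fix i assume "i \<in> ?I"
    then show "(-1) ^ Suc i * f i i
        = (\<Sum>p\<in>?I. \<Sum>q\<in>?I. (if i \<in> {p..q} then (-1) ^ Suc i * w p q else 0))"
      using f[of i i] by (simp add: sum_distrib_left if_distrib cong: if_cong)
  qed simp
  also have "\<dots> = (\<Sum>p\<in>?I. \<Sum>q\<in>?I. \<Sum>i\<in>?I. if i \<in> {p..q} then (-1) ^ Suc i * w p q else 0)"
    by (rule swap)
  also have "\<dots> = (\<Sum>p\<in>?I. \<Sum>q\<in>?I. w p q * of_int (\<Sum>i\<in>{p..q}. (-1) ^ Suc i))"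
    by (intro sum.cong refl, subst restrict) (simp_all add: sum_distrib_left mult.commute)
  also have "\<dots> \<le> (\<Sum>p\<in>?I. \<Sum>q\<in>?I. w p q * of_int ((\<Sum>i\<in>{p..q}. e i)\<^sup>2))"
  proof (intro sum_mono)
    fix p q assume pq: "p \<in> ?I" "q \<in> ?I"
    show "w p q * of_int (\<Sum>i\<in>{p..q}. (-1) ^ Suc i) \<le> w p q * of_int ((\<Sum>i\<in>{p..q}. e i)\<^sup>2)"
    \<comment> \<open>For \<open>p > q\<close> both sums of signs are empty, so the sign of
      \<open>w p q\<close> does not matter.\<close>
    proof (cases "p \<le> q")
      case True
      then have "w p q \<ge> 0" using nonneg pq by (auto simp: w_def)
      then show ?thesis
        by (intro mult_left_mono) (use sum_alternating_le_square[of e p q, OF odd] in \<open>simp only: of_int_le_iff\<close>)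
    qed simp
  qed
  also have "\<dots> = (\<Sum>p\<in>?I. \<Sum>q\<in>?I. \<Sum>i\<in>?I. \<Sum>j\<in>?I.
      if i \<in> {p..q} \<and> j \<in> {p..q} then e i * e j * w p q else 0)"
  proof (intro sum.cong refl)
    fix p q assume pq: "p \<in> ?I" "q \<in> ?I"
    have "(\<Sum>i\<in>?I. \<Sum>j\<in>?I. if i \<in> {p..q} \<and> j \<in> {p..q} then e i * e j * w p q else 0)
        = (\<Sum>i\<in>?I. if i \<in> {p..q} then
            (\<Sum>j\<in>?I. if j \<in> {p..q} then e i * e j * w p q else 0) else 0)"
      by (intro sum.cong) auto
    also have "\<dots> = (\<Sum>i\<in>{p..q}. \<Sum>j\<in>{p..q}. e i * e j * w p q)"
      by (simp only: restrict[OF pq])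
    also have "\<dots> = w p q * of_int ((\<Sum>i\<in>{p..q}. e i)\<^sup>2)"
      by (simp add: power2_eq_square sum_product sum_distrib_left sum_distrib_right mult_ac)
    finally show "w p q * of_int ((\<Sum>i\<in>{p..q}. e i)\<^sup>2)
        = (\<Sum>i\<in>?I. \<Sum>j\<in>?I. if i \<in> {p..q} \<and> j \<in> {p..q} then e i * e j * w p q else 0)" ..
  qed
  also have "\<dots> = (\<Sum>i\<in>?I. \<Sum>j\<in>?I. \<Sum>p\<in>?I. \<Sum>q\<in>?I.
      if i \<in> {p..q} \<and> j \<in> {p..q} then e i * e j * w p q else 0)"
    by (subst swap[symmetric]) (intro sum.cong refl swap[symmetric])
  also have "\<dots> = (\<Sum>i\<in>?I. \<Sum>j\<in>?I. e i * e j * f (min i j) (max i j))"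
    by (intro sum.cong refl) (simp only: f, simp add: sum_distrib_left if_distrib cong: if_cong)
  finally show ?thesis .
qed

section \<open>The upper bound for \<open>Q_prod\<close> on the cube\<close>

lemma four_point_ln:
  fixes a b c :: real
  assumes "0 \<le> a" "a \<le> 1" "0 \<le> b" "b \<le> 1" "0 \<le> c"
  shows "ln (1 + a * c) + ln (1 + b * c) \<le> ln (1 + c) + ln (1 + a * b * c)"
proof -
  \<comment> \<open>This is exactly the difference of the two products compared next; the terms in
    \<open>c\<close> squared cancel.\<close>
  have "0 \<le> c * ((1 - a) * (1 - b))" using assms by simp
  then have "(1 + a * c) * (1 + b * c) \<le> (1 + c) * (1 + a * b * c)"
    by (simp add: algebra_simps)
  moreover have "1 + a * c > 0" "1 + b * c > 0" "1 + c > 0" "1 + a * b * c > 0"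
    using assms by (simp_all add: add_pos_nonneg)
  ultimately show ?thesis
    by (simp add: ln_mult_pos[symmetric])
qed

lemma one_minus_signed_le_exp:
  fixes c :: real and s :: int
  assumes "0 \<le> c" "c \<le> 1" "s = 1 \<or> s = -1"
  shows "1 - s * c \<le> exp (- (s * ln (1 + c)))"
  using assms(3)
proof
  assume "s = 1"
  have "(1 - c) * (1 + c) \<le> 1" by (simp add: algebra_simps)
  then show ?thesis
    using assms \<open>s = 1\<close> by (simp add: exp_minus field_simps)
next
  assume "s = -1"
  then show ?thesis using assms by simp
qed

lemma Q_prod_le:
  assumes "x \<in> cube n"
  shows "Q_prod n x \<le> 2 ^ (Suc n div 2)"
proof -
  \<comment> \<open>Extending by \<open>0\<close> outside \<open>{1..n}\<close> makes
    \<open>c\<close> vanish when its range reaches \<open>0\<close> or \<open>Suc n\<close>, which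
    supplies the zero borders of \<open>f\<close>.\<close>
  define z where "z k = (if k \<in> {1..n} then \<bar>x k\<bar> else 0)" for k
  define c where "c i j = (\<Prod>k\<in>{i..<j}. z k)" for i j
  define s where "s k = (if x k < 0 then -1 else 1::int)" for k
  \<comment> \<open>Prefix products turn the sign of an interval product into
    \<open>e i * e (Suc j)\<close>, because the common prefix squares to 1.\<close>
  define e where "e i = (\<Prod>k\<in>{1..<i}. s k)" for i
  define f where "f i j = ln (1 + c i j)" for i j
  let ?m = "Suc n"
  have x: "\<bar>x k\<bar> \<le> 1" if "k \<in> {1..n}" for k
    using assms that by (auto simp: cube_def PiE_iff abs_le_iff)
  have z: "0 \<le> z k" "z k \<le> 1" for k using x by (auto simp: z_def)
  have c: "0 \<le> c i j" "c i j \<le> 1" for i j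
    using z by (auto simp: c_def intro!: prod_nonneg prod_le_1)
  have e_cases: "e i = 1 \<or> e i = -1" for i
    unfolding e_def by (induction i) (auto simp: s_def prod.atLeastLessThan_Suc split: if_splits)
  have prod_x: "(\<Prod>k\<in>{i..j}. x k) = e i * e (Suc j) * c i (Suc j)"
    if "i \<in> {1..n}" "j \<in> {i..n}" for i j
  proof -
    have "(\<Prod>k\<in>{i..j}. x k) = (\<Prod>k\<in>{i..<Suc j}. s k * z k)"
      using that by (intro prod.cong) (auto simp: s_def z_def)
    also have "\<dots> = (\<Prod>k\<in>{i..<Suc j}. s k) * c i (Suc j)"
      by (simp add: prod.distrib c_def)
    also have "(\<Prod>k\<in>{i..<Suc j}. s k) = e i * (e i * (\<Prod>k\<in>{i..<Suc j}. s k))"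
      using e_cases[of i] by auto
    also have "e i * (\<Prod>k\<in>{i..<Suc j}. s k) = e (Suc j)"
      unfolding e_def using that by (intro prod.atLeastLessThan_concat) auto
    finally show ?thesis by simp
  qed
  let ?S = "\<Sum>i\<in>{1..n}. \<Sum>j\<in>{i..n}. e i * e (Suc j) * f i (Suc j)"
  have sign: "e i * e j = 1 \<or> e i * e j = -1" for i j
    using e_cases[of i] e_cases[of j] by auto
  \<comment> \<open>Comparing the products factor by factor requires nonnegative factors.\<close>
  have nonneg: "0 \<le> 1 - (\<Prod>k\<in>{i..j}. x k)" if "i \<in> {1..n}" "j \<in> {i..n}" for i j
    unfolding prod_x[OF that] using sign[of i "Suc j"] c[of i "Suc j"] by (auto simp flip: of_int_mult)
  have "Q_prod n x \<le> (\<Prod>i\<in>{1..n}. \<Prod>j\<in>{i..n}. exp (- (e i * e (Suc j) * f i (Suc j))))"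
    unfolding Q_prod_def
  proof (intro prod_mono conjI prod_nonneg)
    fix i j assume ij: "i \<in> {1..n}" "j \<in> {i..n}"
    show "1 - (\<Prod>k\<in>{i..j}. x k) \<le> exp (- (e i * e (Suc j) * f i (Suc j)))"
      unfolding prod_x[OF ij] f_def
      using one_minus_signed_le_exp[OF c sign, of i "Suc j"] by simp
  qed (use nonneg in auto)
  also have "\<dots> = exp (- ?S)"
    by (simp add: exp_sum sum_negf[symmetric])
  also have "\<dots> \<le> exp (real (?m div 2) * ln 2)"
  proof -
    have f_diag: "f i i = ln 2" for i by (simp add: f_def c_def)
    have "(\<Sum>i\<in>{1..?m}. (-1) ^ Suc i * f i i)
       \<le> (\<Sum>i\<in>{1..?m}. \<Sum>j\<in>{1..?m}. e i * e j * f (min i j) (max i j))"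
    proof (rule interval_kernel_lower_bound)
      fix k assume "k \<le> Suc ?m" "k > 0"
      then have "c 0 k = 0"
        unfolding c_def by (intro prod_zero bexI[of _ 0]) (auto simp: z_def)
      then show "f 0 k = 0" by (simp add: f_def)
    next
      fix k assume "k \<le> ?m"
      then have "c k (Suc ?m) = 0"
        unfolding c_def by (intro prod_zero bexI[of _ ?m]) (auto simp: z_def)
      then show "f k (Suc ?m) = 0" by (simp add: f_def)
    next
      fix p q assume pq: "1 \<le> p" "p \<le> q" "q \<le> ?m"
      \<comment> \<open>Enlarging the interval to the left or right multiplies \<open>c p q\<close>
        by \<open>z (p - 1)\<close> or \<open>z q\<close>, so the second difference is the one
        bounded in \<open>four_point_ln\<close>.\<close>
      have 1: "c (p - Suc 0) r = z (p - Suc 0) * c p r" if "p \<le> r" for r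
        unfolding c_def using pq that prod.atLeast_Suc_lessThan[of "p - 1" r z] by simp
      have 2: "c p (Suc q) = z q * c p q"
        unfolding c_def using pq by (simp add: mult.commute)
      show "f p q - f (p - 1) q - f p (Suc q) + f (p - 1) (Suc q) \<ge> 0"
        using four_point_ln[of "z (p - 1)" "z q" "c p q"] z c pq
        by (simp add: f_def 1 2 mult.assoc)
    next
      fix i show "odd (e i)" using e_cases[of i] by auto
    qed
    also have "(\<Sum>i\<in>{1..?m}. (-1) ^ Suc i * f i i) = real (?m mod 2) * ln 2"
    proof -
      have "(\<Sum>i\<in>{1..k}. (-1) ^ Suc i * ln 2) = real (k mod 2) * ln 2" for k :: nat
        by (induction k) (auto simp: minus_one_power_iff mod_Suc odd_iff_mod_2_eq_one)
      then show ?thesis by (simp only: f_diag)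
    qed
    also have "(\<Sum>i\<in>{1..?m}. \<Sum>j\<in>{1..?m}. e i * e j * f (min i j) (max i j))
        = (\<Sum>i\<in>{1..?m}. \<Sum>j\<in>{1..?m}. e (min i j) * e (max i j) * f (min i j) (max i j))"
      by (intro sum.cong refl) (auto simp: min_def max_def)
    also have "\<dots> = (\<Sum>i\<in>{1..?m}. e i * e i * f i i) + 2 * ?S"
      by (rule sum_symmetric_square)
    also have "(\<Sum>i\<in>{1..?m}. e i * e i * f i i) = real ?m * ln 2"
    proof -
      have "real_of_int (e i) * real_of_int (e i) = 1" for i using e_cases[of i] by auto
      then show ?thesis by (simp add: f_diag)
    qed
    \<comment> \<open>The full form equals \<open>?m * ln 2 + 2 * ?S\<close> and is at least
      \<open>(?m mod 2) * ln 2\<close>.\<close>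
    finally have "- (2 * ?S) \<le> (real ?m - real (?m mod 2)) * ln 2"
      by (simp add: algebra_simps)
    moreover have "real (2 * (?m div 2) + ?m mod 2) = real ?m"
      by (simp only: mult_div_mod_eq)
    then have "real ?m - real (?m mod 2) = 2 * real (?m div 2)"
      unfolding of_nat_add of_nat_mult of_nat_numeral by linarith
    ultimately have "- (2 * ?S) \<le> 2 * real (?m div 2) * ln 2"
      by (simp only:)
    then have "- ?S \<le> real (?m div 2) * ln 2" by linarith
    then show ?thesis by (simp only: exp_le_cancel_iff)
  qed
  also have "\<dots> = 2 ^ (?m div 2)"
    by (simp add: exp_of_nat_mult)
  finally show ?thesis .
qed

section \<open>The maximizer, its perturbation, and the value of \<open>M_max\<close>\<close>

definition near_extremal :: "real \<Rightarrow> nat \<Rightarrow> real" where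
  "near_extremal d k = (if odd k then d - 1 else d)"

lemma Q_prod_near_extremal_0: "Q_prod n (near_extremal 0) = 2 ^ (Suc n div 2)"
proof -
  have *: "1 - (\<Prod>k\<in>{i..j}. near_extremal 0 k) = (if i = j \<and> odd i then 2 else 1)"
    if "i \<le> j" for i j
  proof (cases "i = j")
    case False
    \<comment> \<open>One of two consecutive indices is even and has entry 0, so only one-element
      intervals at odd indices give a factor other than 1.\<close>
    then have "i \<in> {i..j}" "Suc i \<in> {i..j}" "even i \<or> even (Suc i)"
      using that by auto
    then have "\<exists>k\<in>{i..j}. even k" by blast
    then have "(\<Prod>k\<in>{i..j}. near_extremal 0 k) = 0"
      by (intro prod_zero) (auto simp: near_extremal_def)
    then show ?thesis using False by simp
  qed (simp add: near_extremal_def)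
  have "Q_prod n (near_extremal 0) = (\<Prod>i\<in>{1..n}. \<Prod>j\<in>{i..n}. if i = j \<and> odd i then 2 else 1)"
    unfolding Q_prod_def by (intro prod.cong refl) (use * in auto)
  also have "\<dots> = (\<Prod>i\<in>{1..n}. if odd i then 2 else 1)"
  proof (intro prod.cong refl)
    fix i assume i: "i \<in> {1..n}"
    have "(\<Prod>j\<in>{i..n}. if i = j \<and> odd i then 2 else 1)
        = (\<Prod>j\<in>{i..n}. if i = j then (if odd i then 2 else 1) else (1::real))"
      by (intro prod.cong) auto
    then show "(\<Prod>j\<in>{i..n}. if i = j \<and> odd i then 2 else 1) = (if odd i then 2 else (1::real))"
      using i by (simp add: prod.delta)
  qed
  also have "\<dots> = 2 ^ (Suc n div 2)"
    by (induction n) auto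
  finally show ?thesis .
qed

lemma Q_prod_cong:
  assumes "\<And>k. k \<in> {1..n} \<Longrightarrow> x k = x' k"
  shows "Q_prod n x = Q_prod n x'"
proof -
  have "(\<Prod>k\<in>{i..j}. x k) = (\<Prod>k\<in>{i..j}. x' k)" if "i \<in> {1..n}" "j \<in> {i..n}" for i j
    using that assms by (intro prod.cong) auto
  then show ?thesis
    unfolding Q_prod_def by (intro prod.cong[OF refl]) simp
qed

text \<open>Points of \<open>cube n\<close> are extensional, so \<open>near_extremal 0\<close> must
  be restricted to become one of them.\<close>

lemma Q_prod_restrict: "Q_prod n (restrict x {1..n}) = Q_prod n x"
  by (rule Q_prod_cong) simp

lemma is_greatest_Q_prod:
  "2 ^ (Suc n div 2) \<in> Q_prod n ` cube n" "M_max n = 2 ^ (Suc n div 2)"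
proof -
  have "restrict (near_extremal 0) {1..n} \<in> cube n"
    by (auto simp: cube_def near_extremal_def)
  then show *: "2 ^ (Suc n div 2) \<in> Q_prod n ` cube n"
    using Q_prod_near_extremal_0[of n] by (metis Q_prod_restrict imageI)
  show "M_max n = 2 ^ (Suc n div 2)"
    unfolding M_max_def by (rule Greatest_equality) (use * Q_prod_le in auto)
qed

section \<open>Passage from ratios to the cube, and the value of \<open>P_sup\<close>\<close>

lemma ratio_prod_eq_Q_prod:
  assumes "\<And>k. k \<in> {1..n} \<Longrightarrow> x k = y k / y (Suc k)"
    and nz: "\<And>k. k \<in> {1..Suc n} \<Longrightarrow> y k \<noteq> 0"
  shows "ratio_prod (Suc n) y = Q_prod n x"
proof -
  have prod_x: "(\<Prod>k\<in>{i..j}. x k) = y i / y (Suc j)" if "1 \<le> i" "i \<le> j" "j \<le> n" for i j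
    using that(2,3)
  proof (induction j rule: dec_induct)
    case base
    then show ?case using that by (simp add: assms)
  next
    case (step j)
    then have "(\<Prod>k\<in>{i..Suc j}. x k) = y i / y (Suc j) * (y (Suc j) / y (Suc (Suc j)))"
      using that by (simp add: assms)
    then show ?case using step nz[of "Suc j"] by simp
  qed
  \<comment> \<open>The index \<open>i = Suc n\<close> contributes an empty product.\<close>
  have "ratio_prod (Suc n) y = (\<Prod>i\<in>{1..n}. \<Prod>j\<in>{i<..Suc n}. 1 - y i / y j)"
    by (simp add: ratio_prod_def)
  also have "\<dots> = Q_prod n x"
    unfolding Q_prod_def
  proof (rule prod.cong[OF refl])
    fix i assume i: "i \<in> {1..n}"
    have "(\<Prod>j\<in>{i..n}. 1 - (\<Prod>k\<in>{i..j}. x k)) = (\<Prod>j\<in>{i..n}. 1 - y i / y (Suc j))"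
      using i prod_x by (intro prod.cong) auto
    also have "\<dots> = (\<Prod>j\<in>{i<..Suc n}. 1 - y i / y j)"
      by (rule prod.reindex_bij_witness[of _ "\<lambda>j. j - 1" Suc]) auto
    finally show "(\<Prod>j\<in>{i<..Suc n}. 1 - y i / y j) = (\<Prod>j\<in>{i..n}. 1 - (\<Prod>k\<in>{i..j}. x k))" ..
  qed
  finally show ?thesis .
qed

lemma ratio_prod_le:
  assumes "y \<in> abs_increasing (Suc n)"
  shows "ratio_prod (Suc n) y \<le> 2 ^ (Suc n div 2)"
proof -
  let ?x = "\<lambda>k\<in>{1..n}. y k / y (Suc k)"
  have nz: "y k \<noteq> 0" if "k \<in> {1..Suc n}" for k
    using assms that by (auto simp: abs_increasing_def PiE_def Pi_def)
  have "\<bar>y k\<bar> < \<bar>y (Suc k)\<bar>" if "k \<in> {1..n}" for k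
    using assms that by (auto simp: abs_increasing_def strict_mono_on_def)
  then have "\<bar>y k / y (Suc k)\<bar> \<le> 1" if "k \<in> {1..n}" for k
    using that by (force simp: abs_divide divide_le_eq_1)
  then have "y k / y (Suc k) \<in> {-1..1}" if "k \<in> {1..n}" for k
    using that by (metis abs_le_iff atLeastAtMost_iff minus_le_iff)
  then have "?x \<in> cube n"
    unfolding cube_def by (rule restrict_PiE_iff[THEN iffD2, rule_format])
  moreover have "ratio_prod (Suc n) y = Q_prod n ?x"
    by (rule ratio_prod_eq_Q_prod) (use nz in auto)
  ultimately show ?thesis using Q_prod_le by simp
qed

lemma Q_prod_in_ratio_prods:
  assumes x: "\<And>k. k \<in> {1..n} \<Longrightarrow> x k \<noteq> 0 \<and> \<bar>x k\<bar> < 1"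
  shows "Q_prod n x \<in> ratio_prod (Suc n) ` abs_increasing (Suc n)"
proof
  \<comment> \<open>Start from \<open>y 1 = 1\<close> and solve
    \<open>y (Suc k) = y k / x k\<close>; since \<open>x k\<close> has modulus below 1, the moduli
    increase.\<close>
  let ?y = "\<lambda>k\<in>{1..Suc n}. inverse (\<Prod>j\<in>{1..<k}. x j)"
  have nz: "(\<Prod>j\<in>{1..<k}. x j) \<noteq> 0" if "k \<le> Suc n" for k
    using x that by auto
  show "Q_prod n x = ratio_prod (Suc n) ?y"
  proof (rule ratio_prod_eq_Q_prod[symmetric])
    fix k assume k: "k \<in> {1..n}"
    then show "x k = ?y k / ?y (Suc k)"
      using nz[of k] by (simp add: field_simps)
  qed (use nz in auto)
  have step: "\<bar>?y j\<bar> < \<bar>?y (Suc j)\<bar>" if "j \<in> {1..n}" for j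
  proof -
    have "\<bar>x j\<bar> * \<bar>\<Prod>j\<in>{1..<j}. x j\<bar> < 1 * \<bar>\<Prod>j\<in>{1..<j}. x j\<bar>"
      using x[OF that] nz[of j] that by (intro mult_strict_right_mono) auto
    then show ?thesis
      using that x[OF that] nz[of j] by (simp add: abs_mult one_less_inverse)
  qed
  have "\<bar>?y i\<bar> < \<bar>?y j\<bar>" if "i < j" "1 \<le> i" "j \<le> Suc n" for i j
    using that(1,3)
  proof (induction j)
    case (Suc j)
    then have "\<bar>?y j\<bar> < \<bar>?y (Suc j)\<bar>" using that(2) by (intro step) auto
    moreover have "i = j \<or> \<bar>?y i\<bar> < \<bar>?y j\<bar>" using Suc by (auto simp: less_Suc_eq)
    ultimately show ?case by fastforce
  qed simp
  then have "strict_mono_on {1..Suc n} (\<lambda>i. \<bar>?y i\<bar>)"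
    by (intro strict_mono_onI) auto
  moreover have "?y \<in> {1..Suc n} \<rightarrow>\<^sub>E (UNIV - {0})"
    using nz by auto
  ultimately show "?y \<in> abs_increasing (Suc n)"
    by (simp add: abs_increasing_def)
qed

text \<open>Boundedness is established as well, since \<open>Sup\<close> on the reals is a true
  supremum only for nonempty sets bounded above.\<close>

lemma P_sup_eq:
  "bdd_above (ratio_prod (Suc n) ` abs_increasing (Suc n))"
  "P_sup (Suc n) = 2 ^ (Suc n div 2)"
proof -
  let ?R = "ratio_prod (Suc n) ` abs_increasing (Suc n)"
  show bdd: "bdd_above ?R"
    by (rule bdd_aboveI) (use ratio_prod_le in auto)
  \<comment> \<open>For such \<open>d\<close> both \<open>d - 1\<close> and \<open>d\<close> are
    nonzero with modulus below 1, unlike the entries of the maximizer at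
    \<open>d = 0\<close>.\<close>
  have in_R: "Q_prod n (near_extremal d) \<in> ?R" if "0 < d" "d < 1" for d
    using that by (intro Q_prod_in_ratio_prods) (auto simp: near_extremal_def)
  \<comment> \<open>The maximizer does not come from ratios, so its value is reached only as a limit
    of values in \<open>?R\<close>.\<close>
  have "((\<lambda>d. Q_prod n (near_extremal d)) \<longlongrightarrow> Q_prod n (near_extremal 0)) (at_right 0)"
  proof -
    have "((\<lambda>d. near_extremal d k) \<longlongrightarrow> near_extremal 0 k) (at_right 0)" for k
      by (cases "even k") (auto simp: near_extremal_def intro!: tendsto_eq_intros)
    then show ?thesis
      unfolding Q_prod_def by (intro tendsto_intros)
  qed
  moreover have "\<forall>\<^sub>F d in at_right 0. Q_prod n (near_extremal d) \<le> P_sup (Suc n)"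
    unfolding P_sup_def eventually_at_right_field
    using in_R bdd by (intro exI[of _ 1]) (auto intro: cSup_upper)
  ultimately have "Q_prod n (near_extremal 0) \<le> P_sup (Suc n)"
    by (intro tendsto_upperbound[of _ _ "at_right 0"]) auto
  moreover have "P_sup (Suc n) \<le> 2 ^ (Suc n div 2)"
    unfolding P_sup_def
  proof (rule cSup_least)
    show "?R \<noteq> {}" using in_R[of "1/2"] by auto
  qed (use ratio_prod_le in auto)
  ultimately show "P_sup (Suc n) = 2 ^ (Suc n div 2)"
    by (simp add: Q_prod_near_extremal_0)
qed

lemma nat_floor_half: "nat \<lfloor>real n / 2\<rfloor> = n div 2"
  by (metis floor_divide_of_nat_eq nat_int of_nat_numeral)

theorem theorem1:
  shows "(\<forall>n::nat. n \<ge> 1 \<longrightarrow>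
            M_max n \<in> Q_prod n ` cube n \<and> (\<forall>x\<in>cube n. Q_prod n x \<le> M_max n) \<and>
            M_max n = 2 ^ nat \<lfloor>(real n + 1) / 2\<rfloor>) \<and>
         (\<forall>n::nat. n \<ge> 2 \<longrightarrow>
            bdd_above (ratio_prod n ` abs_increasing n) \<and>
            P_sup n = M_max (n - 1) \<and> M_max (n - 1) = 2 ^ nat \<lfloor>real n / 2\<rfloor>)"
proof (intro conjI allI impI)
  fix n :: nat
  show "M_max n \<in> Q_prod n ` cube n" "\<forall>x\<in>cube n. Q_prod n x \<le> M_max n"
    using is_greatest_Q_prod[of n] Q_prod_le by auto
  show "M_max n = 2 ^ nat \<lfloor>(real n + 1) / 2\<rfloor>"
    using is_greatest_Q_prod(2)[of n] nat_floor_half[of "Suc n"] by (simp add: add.commute)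
next
  fix n :: nat
  assume "n \<ge> 2"
  then obtain m where n: "n = Suc m" by (cases n) auto
  show "bdd_above (ratio_prod n ` abs_increasing n)"
    unfolding n by (rule P_sup_eq)
  show "P_sup n = M_max (n - 1)"
    unfolding n by (simp only: P_sup_eq is_greatest_Q_prod diff_Suc_1)
  show "M_max (n - 1) = 2 ^ nat \<lfloor>real n / 2\<rfloor>"
    unfolding nat_floor_half unfolding n by (simp only: is_greatest_Q_prod diff_Suc_1)
qed

end
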